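(* Let $\mathcal{A}$ be a unital associative algebra over a field $\mathrm{k}$ and $U(\mathcal{A})$ its group of invertible elements. Let $A,B,C$ be finite nonempty subsets of $\mathcal{A}$ with $B\subseteq U(\mathcal{A})$. Then \[\dim_{\mathrm{k}}(ABC)^{2}\leq\dim_{\mathrm{k}}(AB)\dim_{\mathrm{k}}(BC)\max_{b\in B}\{\dim_{\mathrm{k}}(AbC)\}.\] In particular, when $\mathcal{A}$ is commutative, \[\dim_{\mathrm{k}}(ABC)^{2}\leq\dim_{\mathrm{k}}(AB)\dim_{\mathrm{k}}(BC)\dim_{\mathrm{k}}(AC).\]
   Context: For $Y\subseteq\mathcal{A}$, $\dim_{\mathrm{k}}(Y)$ is the dimension over $\mathrm{k}$ of the $\mathrm{k}$-linear span of $Y$. Products of sets are Minkowski products. *)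

theory Defs
  imports Complex_Main "HOL-Library.Set_Algebras"
begin

text \<open>
  The sort \<open>{ring, monoid_mult}\<close> is an associative ring with unit; unlike \<open>ring_1\<close> it does not
  exclude the zero ring. No commutativity is assumed. The inherited \<open>dim\<close> of a set is the
  dimension of its linear span, and \<open>*\<close> on sets (from \<open>Set_Algebras\<close>) is the Minkowski product.
\<close>

locale unital_algebra = vector_space scale
  for scale :: "'k::field \<Rightarrow> 'a::{ring, monoid_mult} \<Rightarrow> 'a" +
  assumes scale_mult_left: "scale r x * y = scale r (x * y)"
    and scale_mult_right: "x * scale r y = scale r (x * y)"

definition invertibles :: "'a::monoid_mult set" where
  "invertibles = {x. \<exists>y. x * y = 1 \<and> y * x = 1}"

end

theory Submission
  imports Defs
begin

text \<open>
  Add the elements of \<open>B\<close> one at a time, and let \<open>p\<close>, \<open>q\<close>, \<open>d\<close> be the amounts by which the dimensions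
  of \<open>AB\<close>, \<open>BC\<close> and \<open>ABC\<close> grow when \<open>b\<close> is added. Clearly \<open>d \<le> dim (AbC)\<close>. Moreover \<open>d \<le> p q\<close>:
  if \<open>A' \<subseteq> A\<close> and \<open>C' \<subseteq> C\<close> are such that \<open>A'b\<close> and \<open>bC'\<close> are bases of \<open>Ab\<close> and \<open>bC\<close> modulo the
  earlier spans, then \<open>A'bC'\<close> spans \<open>AbC\<close> modulo the earlier span. Hence \<open>d\<^sup>2 \<le> M p q\<close> with
  \<open>M = max dim (AbC)\<close>, and the Cauchy--Schwarz inequality sums this up to the claim.
\<close>

context vector_space
begin

lemma dim_empty_set: "dim {} = 0"
  using dim_eq_card_independent[OF independent_empty] by simp

lemma finite_basis_of_finite_set:
  assumes "finite S"
  obtains W where "W \<subseteq> S" "finite W" "independent W" "S \<subseteq> span W" "card W = dim S"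
  using basis_exists[of S] assms finite_subset by metis

lemma dim_Un_le:
  assumes "finite S" "finite W" "T \<subseteq> span (S \<union> W)"
  shows "dim (S \<union> T) \<le> dim S + card W"
proof -
  obtain X where X: "finite X" "S \<subseteq> span X" "card X = dim S"
    using finite_basis_of_finite_set[OF assms(1)] by metis
  have S: "S \<subseteq> span (X \<union> W)"
    using X(2) span_mono[of X "X \<union> W"] by blast
  have "S \<union> W \<subseteq> span (X \<union> W)"
    using S span_superset[of "X \<union> W"] by blast
  then have "S \<union> T \<subseteq> span (X \<union> W)"
    using S assms(3) span_minimal[OF _ subspace_span] by blast
  then have "dim (S \<union> T) \<le> card (X \<union> W)"
    using dim_le_card X(1) assms(2) by blast
  also have "\<dots> \<le> dim S + card W"
    using card_Un_le[of X W] X(3) by simp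
  finally show ?thesis .
qed

lemma dim_Un_le_add:
  assumes "finite S" "finite T"
  shows "dim (S \<union> T) \<le> dim S + dim T"
proof -
  obtain W where W: "finite W" "T \<subseteq> span W" "card W = dim T"
    using finite_basis_of_finite_set[OF assms(2)] by metis
  have "T \<subseteq> span (S \<union> W)"
    using W(2) span_mono[of W "S \<union> W"] by blast
  then show ?thesis
    using dim_Un_le[OF assms(1) W(1)] W(3) by simp
qed

text \<open>A basis \<open>X\<close> of \<open>span S\<close> extends, by vectors of
  \<open>T\<close> alone, to a basis \<open>Y\<close> of \<open>span (S \<union> T)\<close>. The
  added vectors \<open>Y - X\<close> are a basis of \<open>T\<close> modulo \<open>span S\<close>,
  so their number is exactly the growth of the dimension.\<close>

lemma relative_basis_exists:
  assumes "finite S" "finite T"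
  obtains W where "W \<subseteq> T" "T \<subseteq> span (S \<union> W)" "dim (S \<union> T) = dim S + card W"
proof -
  obtain X where X: "X \<subseteq> S" "finite X" "independent X" "S \<subseteq> span X" "card X = dim S"
    using finite_basis_of_finite_set[OF assms(1)] by metis
  obtain Y where Y: "X \<subseteq> Y" "Y \<subseteq> X \<union> T" "independent Y" "X \<union> T \<subseteq> span Y"
    using maximal_independent_subset_extend[of X "X \<union> T"] X(3) by blast
  have fin: "finite Y"
    using Y(2) X(2) assms(2) finite_subset by blast
  have "S \<subseteq> span Y"
    using X(4) span_mono[OF Y(1)] by blast
  moreover have "Y \<subseteq> S \<union> T"
    using X(1) Y(2) by blast
  ultimately have "card Y = dim (S \<union> T)"
    using Y(3,4) basis_card_eq_dim[of Y "S \<union> T"] by blast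
  moreover have "card Y = card X + card (Y - X)"
    using Y(1) fin by (metis card_Diff_subset X(2) card_mono le_add_diff_inverse)
  moreover have "Y \<subseteq> S \<union> (Y - X)"
    using X(1) by blast
  then have "T \<subseteq> span (S \<union> (Y - X))"
    using Y(4) span_mono[of Y "S \<union> (Y - X)"] by blast
  ultimately show ?thesis
    using that[of "Y - X"] Y(2) X(5) by auto
qed

text \<open>One preimage is chosen for each relative basis vector, so \<open>f\<close> is injective
  on \<open>A'\<close> and \<open>card A'\<close> is the exact increment. The intended
  \<open>f\<close> is multiplication by \<open>b\<close> on one side.\<close>

lemma relative_basis_image_exists:
  assumes "finite S" "finite A"
  obtains A' where "A' \<subseteq> A" "f ` A \<subseteq> span (S \<union> f ` A')" "dim (S \<union> f ` A) = dim S + card A'"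
proof -
  obtain W where W: "W \<subseteq> f ` A" "f ` A \<subseteq> span (S \<union> W)" "dim (S \<union> f ` A) = dim S + card W"
    using relative_basis_exists[OF assms(1) finite_imageI[OF assms(2)]] by metis
  obtain A' where "A' \<subseteq> A" "inj_on f A'" "W = f ` A'"
    using W(1) by (auto simp: subset_image_inj)
  then show ?thesis
    using that[of A'] W by (simp add: card_image)
qed

end

context unital_algebra
begin

lemma span_times_right:
  assumes "x \<in> span S" "\<And>s. s \<in> S \<Longrightarrow> s * c \<in> span V"
  shows "x * c \<in> span V"
  using assms(1)
  by (induction rule: span_induct_alt)
    (auto simp: span_zero distrib_right scale_mult_left intro: span_add span_scale assms(2))

lemma span_times_left:
  assumes "x \<in> span S" "\<And>s. s \<in> S \<Longrightarrow> c * s \<in> span V"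
  shows "c * x \<in> span V"
  using assms(1)
  by (induction rule: span_induct_alt)
    (auto simp: span_zero distrib_left scale_mult_right intro: span_add span_scale assms(2))

lemma dim_triple_product_insert_le:
  assumes fin: "finite A" "finite F" "finite C"
  obtains p q where
    "dim (A * insert b F) = dim (A * F) + p"
    "dim (insert b F * C) = dim (F * C) + q"
    "dim (A * insert b F * C) \<le> dim (A * F * C) + p * q"
proof -
  let ?V = "A * F * C"
  have A_insert: "A * insert b F = A * F \<union> (\<lambda>a. a * b) ` A"
    and C_insert: "insert b F * C = F * C \<union> (*) b ` C"
    and AC_insert: "A * insert b F * C = ?V \<union> A * {b} * C"
    by (auto simp: set_times_def)
  obtain A' where A': "A' \<subseteq> A" "(\<lambda>a. a * b) ` A \<subseteq> span (A * F \<union> (\<lambda>a. a * b) ` A')"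
      "dim (A * F \<union> (\<lambda>a. a * b) ` A) = dim (A * F) + card A'"
    using relative_basis_image_exists[OF finite_set_times[OF fin(1,2)] fin(1)] by metis
  obtain C' where C': "C' \<subseteq> C" "(*) b ` C \<subseteq> span (F * C \<union> (*) b ` C')"
      "dim (F * C \<union> (*) b ` C) = dim (F * C) + card C'"
    using relative_basis_image_exists[OF finite_set_times[OF fin(2,3)] fin(3)] by metis
  define W where "W = (\<lambda>(a, c). a * b * c) ` (A' \<times> C')"
  have fin': "finite A'" "finite C'"
    using A'(1) C'(1) fin finite_subset by auto
  have W: "finite W" "card W \<le> card A' * card C'"
    using fin' card_image_le[of "A' \<times> C'"] by (auto simp: W_def card_cartesian_product)
  \<comment> \<open>The right factor is reduced first, with \<open>a\<close> already in
    \<open>A'\<close>. Expand \<open>b * c\<close> over \<open>F * C\<close> and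
    \<open>b * C'\<close>: left multiplication by \<open>a\<close> sends the former into
    \<open>?V\<close> and the latter into \<open>W\<close>.\<close>
  have left: "a * (b * c) \<in> span (?V \<union> W)" if "a \<in> A'" "c \<in> C" for a c
  proof (rule span_times_left[of _ "F * C \<union> (*) b ` C'"])
    show "b * c \<in> span (F * C \<union> (*) b ` C')"
      using C'(2) that by blast
    show "a * s \<in> span (?V \<union> W)" if "s \<in> F * C \<union> (*) b ` C'" for s
      using that
    proof
      assume "s \<in> F * C"
      then have "a * s \<in> ?V"
        using \<open>a \<in> A'\<close> A'(1) by (auto simp: mult.assoc)
      then show ?thesis
        by (simp add: span_base)
    next
      assume "s \<in> (*) b ` C'"
      then have "a * s \<in> W"
        using \<open>a \<in> A'\<close> by (auto simp: W_def mult.assoc image_iff)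
      then show ?thesis
        by (simp add: span_base)
    qed
  qed
  \<comment> \<open>For general \<open>a\<close>, expand \<open>a * b\<close> over
    \<open>A * F\<close> and \<open>A' * b\<close>: times \<open>c\<close>, the former lies in
    \<open>?V\<close> and the latter is covered by \<open>left\<close>.\<close>
  have "a * b * c \<in> span (?V \<union> W)" if "a \<in> A" "c \<in> C" for a c
  proof (rule span_times_right[of _ "A * F \<union> (\<lambda>a. a * b) ` A'"])
    show "a * b \<in> span (A * F \<union> (\<lambda>a. a * b) ` A')"
      using A'(2) that by blast
    show "s * c \<in> span (?V \<union> W)" if "s \<in> A * F \<union> (\<lambda>a. a * b) ` A'" for s
      using that
    proof
      assume "s \<in> A * F"
      then show ?thesis
        using \<open>c \<in> C\<close> by (auto intro: span_base)
    next
      assume "s \<in> (\<lambda>a. a * b) ` A'"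
      then show ?thesis
        using left \<open>c \<in> C\<close> by (auto simp: mult.assoc)
    qed
  qed
  then have "A * {b} * C \<subseteq> span (?V \<union> W)"
    by (auto simp: set_times_def)
  then have "dim (A * insert b F * C) \<le> dim ?V + card W"
    unfolding AC_insert using dim_Un_le W(1) fin by (simp add: finite_set_times)
  then show ?thesis
    using that[of "card A'" "card C'"] A'(3) C'(3) W(2) A_insert C_insert by simp
qed

end

text \<open>Two-term Cauchy-Schwarz: the two bounds on \<open>d\<close> multiply to
  \<open>d\<^sup>2 \<le> p * q * M\<close>, and AM-GM bounds the cross term \<open>2 * v * d\<close>
  by \<open>(P * q + p * Q) * M\<close>. Adding these to the bound on \<open>v\<^sup>2\<close> gives
  the expanded right-hand side.\<close>

lemma cauchy_schwarz_increment:
  fixes v d p q P Q M :: nat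
  assumes v: "v\<^sup>2 \<le> P * Q * M" and d: "d \<le> M" "d \<le> p * q"
  shows "(v + d)\<^sup>2 \<le> (P + p) * (Q + q) * M"
proof -
  have d2: "d\<^sup>2 \<le> p * q * M"
    using mult_mono[OF d(2,1)] by (simp add: power2_eq_square)
  have am_gm: "4 * x * y \<le> (x + y)\<^sup>2" for x y :: nat
  proof -
    have "0 \<le> (int x - int y)\<^sup>2"
      by simp
    then have "int (4 * x * y) \<le> int ((x + y)\<^sup>2)"
      by (simp add: power2_eq_square algebra_simps)
    then show ?thesis
      by (simp only: of_nat_le_iff)
  qed
  \<comment> \<open>The cross term is compared through its square, which keeps square roots out and
    the argument within \<open>nat\<close>.\<close>
  have "(2 * v * d)\<^sup>2 = 4 * (v\<^sup>2 * d\<^sup>2)"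
    by (simp add: power2_eq_square)
  also have "\<dots> \<le> 4 * ((P * Q * M) * (p * q * M))"
    by (intro mult_left_mono mult_mono v d2) auto
  also have "\<dots> = 4 * (P * q) * (p * Q) * M\<^sup>2"
    by (simp add: power2_eq_square)
  also have "\<dots> \<le> (P * q + p * Q)\<^sup>2 * M\<^sup>2"
    using am_gm by (intro mult_right_mono) auto
  also have "\<dots> = ((P * q + p * Q) * M)\<^sup>2"
    by (rule power_mult_distrib[symmetric])
  finally have "2 * v * d \<le> (P * q + p * Q) * M"
    by (rule power2_le_imp_le) (rule zero_le)
  then show ?thesis
    using v d2 by (simp add: power2_eq_square algebra_simps)
qed

context unital_algebra
begin

text \<open>A fixed bound \<open>M\<close> in place of the maximum stays the same throughout the
  induction, and also allows \<open>dim (A * C)\<close> in the commutative case.\<close>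

lemma dim_triple_product_square_le:
  assumes "finite B" and fin: "finite A" "finite C"
    and "\<And>b. b \<in> B \<Longrightarrow> dim (A * {b} * C) \<le> M"
  shows "(dim (A * B * C))\<^sup>2 \<le> dim (A * B) * dim (B * C) * M"
  using assms(1,4)
proof (induction B)
  case empty
  have "A * {} * C = {}"
    by (auto simp: set_times_def)
  then show ?case
    by (simp add: dim_empty_set)
next
  case (insert b F)
  obtain p q where pq: "dim (A * insert b F) = dim (A * F) + p"
      "dim (insert b F * C) = dim (F * C) + q"
      "dim (A * insert b F * C) \<le> dim (A * F * C) + p * q"
    using dim_triple_product_insert_le[OF fin(1) insert.hyps(1) fin(2)] by metis
  have "A * insert b F * C = A * F * C \<union> A * {b} * C"
    by (auto simp: set_times_def)
  then have "dim (A * insert b F * C) \<le> dim (A * F * C) + dim (A * {b} * C)"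
    using dim_Un_le_add fin insert.hyps(1) by (simp add: finite_set_times)
  then have "dim (A * insert b F * C) \<le> dim (A * F * C) + M"
    using insert.prems[of b] by simp
  \<comment> \<open>The increment is replaced by the smaller of its two upper bounds, which meets
    both conditions on \<open>d\<close> in \<open>cauchy_schwarz_increment\<close>.\<close>
  then have "(dim (A * insert b F * C))\<^sup>2 \<le> (dim (A * F * C) + min M (p * q))\<^sup>2"
    using pq(3) by (intro power_mono) auto
  also have "\<dots> \<le> (dim (A * F) + p) * (dim (F * C) + q) * M"
    using insert by (intro cauchy_schwarz_increment) auto
  finally show ?case
    using pq by simp
qed

lemma dim_triple_product_singleton_le:
  assumes "finite A" "finite C" and comm: "\<And>x y :: 'a. x * y = y * x"
  shows "dim (A * {b} * C) \<le> dim (A * C)"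
proof -
  obtain W where W: "finite W" "A * C \<subseteq> span W" "card W = dim (A * C)"
    using finite_basis_of_finite_set[OF finite_set_times[OF assms(1,2)]] by metis
  have "a * b * c \<in> span ((*) b ` W)" if "a \<in> A" "c \<in> C" for a c
  proof -
    have "b * (a * c) \<in> span ((*) b ` W)"
    proof (rule span_times_left)
      show "a * c \<in> span W"
        using W(2) that by blast
    qed (simp add: span_base)
    then show ?thesis
      by (metis comm mult.assoc)
  qed
  then have "A * {b} * C \<subseteq> span ((*) b ` W)"
    by (auto simp: set_times_def)
  then have "dim (A * {b} * C) \<le> card ((*) b ` W)"
    using dim_le_card W(1) by blast
  then show ?thesis
    using card_image_le[OF W(1), of "(*) b"] W(3) by simp
qed

end

theorem theorem4p3:
  fixes scale :: "'k::field \<Rightarrow> 'a::{ring, monoid_mult} \<Rightarrow> 'a"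
    and A B C :: "'a set"
  assumes "unital_algebra scale"
    and "finite A" "A \<noteq> {}"
    and "finite B" "B \<noteq> {}"
    and "finite C" "C \<noteq> {}"
    and "B \<subseteq> invertibles"
  shows "(vector_space.dim scale (A * B * C))\<^sup>2
           \<le> vector_space.dim scale (A * B) * vector_space.dim scale (B * C)
             * Max ((\<lambda>b. vector_space.dim scale (A * {b} * C)) ` B)
       \<and> ((\<forall>x y :: 'a. x * y = y * x) \<longrightarrow>
           (vector_space.dim scale (A * B * C))\<^sup>2
             \<le> vector_space.dim scale (A * B) * vector_space.dim scale (B * C)
               * vector_space.dim scale (A * C))"
proof -
  interpret unital_algebra scale
    by fact
  show ?thesis
    using assms(2,4,6)
    by (auto intro!: dim_triple_product_square_le dim_triple_product_singleton_le)
qed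

end
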